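(* Let $d\ge2$, let $S^{d-1}$ be the unit sphere in $\mathbb{R}^d$, let $\delta<\frac14$, and let $f_1,f_2,\ldots,f_n:S^{d-1}\to\mathbb{R}^d$ be continuous maps satisfying: - $\|f_i(x)-f_i(y)\|\ge\|x-y\|-\delta$ for all $x,y\in S^{d-1}$ and all $i$; - $\|f_i(x)-f_j(x)\|\le\frac14$ for all $i,j$ and all $x\in S^{d-1}$; and - $\Sigma_i\cap\Sigma_j=\emptyset$ whenever $i\ne j$, where $\Sigma_i=f_i(S^{d-1})$. Let $U_i$ denote the unbounded component of $\mathbb{R}^d\setminus\Sigma_i$, and define a relation $\preceq$ on $[n]$ by setting $i\preceq j$ if $U_j\subseteq U_i$. Then $\preceq$ is a linear ordering on $[n]$.
   Context: $\|\cdot\|$ is the Euclidean norm and $[n]=\{1,2,\ldots,n\}$. A linear ordering is a reflexive, antisymmetric, transitive and total relation. *)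

theory Defs
  imports "HOL-Analysis.Analysis"
begin

text \<open>
  For a bounded set \<open>S\<close> in dimension at least 2 the complement has exactly one unbounded connected
  component, so the definite description below is well defined; see \<open>unbounded_component_unique\<close>.
\<close>

definition unbounded_component :: "'a::euclidean_space set \<Rightarrow> 'a set" where
  "unbounded_component S = (THE U. U \<in> components (- S) \<and> \<not> bounded U)"

lemma unbounded_component_unique:
  fixes S :: "'a::euclidean_space set"
  assumes "bounded S" and "2 \<le> DIM('a)"
  shows "\<exists>!U. U \<in> components (- S) \<and> \<not> bounded U"
  using assms cobounded_unbounded_components[of "- S"]
    cobounded_unique_unbounded_components[of "- S"]
  by auto

lemma unbounded_component:
  fixes S :: "'a::euclidean_space set"
  assumes "bounded S" and "2 \<le> DIM('a)"
  shows "unbounded_component S \<in> components (- S)" and "\<not> bounded (unbounded_component S)"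
  using theI'[OF unbounded_component_unique[OF assms]]
  by (simp_all add: unbounded_component_def)

end

(*
  Two disjoint sets Sigma_i, Sigma_j are comparable unless each lies in the unbounded component of
  the complement of the other.  In that case the compact sets K_i, K_j obtained by filling in the
  bounded components are disjoint.  The expansion hypothesis gives a continuous approximate left
  inverse g of f_i that is nonzero on the union M of the segments [f_i x, f_j x].  By Borsuk,
  sgn o g extends from M Int K_i to a sphere-valued map G on the complement of a finite set of
  points of K_i - M.  There G o f_i is homotopic to G o f_j along the segments, and G o f_j is
  nullhomotopic because it factors through K_j, which does not separate space.  But G o f_i is
  homotopic to the identity of the sphere.  For antisymmetry, a common unbounded component would
  have its nonempty frontier in the intersection of Sigma_i and Sigma_j.
*)

theory Submission
  imports Defs
begin

text \<open>\<open>outside S\<close> is the union of all unbounded components of the complement; in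
  dimension at least 2 it is connected, hence a single component.\<close>

lemma outside_in_components:
  fixes S :: "'a::euclidean_space set"
  assumes "bounded S" and "2 \<le> DIM('a)"
  shows "outside S \<in> components (- S)"
proof -
  obtain x where x: "x \<in> outside S"
    using unbounded_outside[OF assms(1)] by fastforce
  have "connected_component_set (- S) x = outside S"
  proof
    show "connected_component_set (- S) x \<subseteq> outside S"
      using outside_same_component x by blast
    show "outside S \<subseteq> connected_component_set (- S) x"
      using x connected_outside[OF assms] outside_no_overlap[of S]
      by (intro connected_component_maximal) blast+
  qed
  moreover have "x \<in> - S"
    using x outside_no_overlap[of S] by blast
  ultimately show ?thesis
    unfolding components_def by blast
qed

text \<open>Trades the definite description for \<open>outside\<close>, so that facts on its
  connectedness, openness and frontier apply.\<close>

lemma unbounded_component_eq_outside: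
  fixes S :: "'a::euclidean_space set"
  assumes "bounded S" and "2 \<le> DIM('a)"
  shows "unbounded_component S = outside S"
  using unbounded_component_unique[OF assms] unbounded_component[OF assms]
    outside_in_components[OF assms] unbounded_outside[OF assms(1)] by blast

text \<open>A connected \<open>T\<close> missing \<open>S\<close> lies in one component of
  \<open>- S\<close>. If that is not \<open>outside S\<close>, then \<open>outside S\<close> is a
  connected unbounded set avoiding \<open>T\<close>, so it stays within the unbounded part of
  \<open>- T\<close>.\<close>

lemma outside_subset_outside:
  fixes S T :: "'a::euclidean_space set"
  assumes "bounded S" "connected T" "bounded T" "2 \<le> DIM('a)"
    and "S \<inter> T = {}" "\<not> T \<subseteq> outside S"
  shows "outside S \<subseteq> outside T"
proof -
  have "outside S \<inter> T = {}"
    using components_maximal[OF outside_in_components[OF assms(1,4)] assms(2)] assms(5,6)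
    by blast
  then have "outside S \<subseteq> - T"
    by blast
  moreover have "connected (outside S)" "\<not> bounded (outside S)"
    using assms by (auto simp: connected_outside unbounded_outside)
  ultimately show ?thesis
    by (metis bounded_subset connected_component_maximal mem_Collect_eq outside subsetI)
qed

text \<open>Equivalently, the filled-in sets are disjoint. Closing up \<open>outside S\<close> adds
  only points of \<open>S\<close>, which \<open>outside T\<close> absorbs, and vice versa, so the
  union is clopen.\<close>

lemma outside_Un_outside_eq_UNIV:
  fixes S T :: "'a::euclidean_space set"
  assumes "compact S" "compact T" "S \<subseteq> outside T" "T \<subseteq> outside S"
  shows "outside S \<union> outside T = UNIV"
proof -
  have "closure (outside S) \<subseteq> S \<union> outside S" "closure (outside T) \<subseteq> T \<union> outside T"
    using closure_outside_subset assms(1,2) compact_imp_closed by blast+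
  then have "closed (outside S \<union> outside T)"
    using assms(3,4) closure_subset_eq by fastforce
  moreover have "open (outside S \<union> outside T)"
    using assms by (simp add: compact_imp_closed open_Un open_outside)
  moreover have "outside S \<noteq> {}"
    using unbounded_outside[of S] assms(1) by (metis bounded_empty compact_imp_bounded)
  ultimately show ?thesis
    using clopen[of "outside S \<union> outside T"] by blast
qed

text \<open>Average finitely many net points \<open>t\<close>, weighted by bumps around
  \<open>f t\<close>. If \<open>y\<close> is near \<open>f x\<close>, only those \<open>t\<close>
  with \<open>f t\<close> near \<open>f x\<close> count; expansion puts them close to
  \<open>x\<close>, so each has positive inner product with \<open>x\<close>.\<close>

lemma coarse_embedding_approximate_inverse:
  fixes f :: "'a::euclidean_space \<Rightarrow> 'b::euclidean_space"
  assumes \<delta>: "\<delta> < 1/4" and cont: "continuous_on (sphere 0 1) f"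
    and exp: "\<And>x y. \<lbrakk>x \<in> sphere 0 1; y \<in> sphere 0 1\<rbrakk> \<Longrightarrow> norm (x - y) - \<delta> \<le> norm (f x - f y)"
  obtains g where "continuous_on UNIV g"
    "\<And>x y. \<lbrakk>x \<in> sphere 0 1; norm (y - f x) \<le> 1/4\<rbrakk> \<Longrightarrow> g y \<bullet> x > 0"
proof -
  have "compact (f ` sphere 0 1)"
    by (intro compact_continuous_image cont compact_sphere)
  moreover have "f ` sphere 0 1 \<subseteq> (\<Union>t\<in>sphere 0 1. ball (f t) (1/8))"
    by force
  ultimately obtain T where T: "T \<subseteq> sphere 0 1" "finite T"
      "f ` sphere 0 1 \<subseteq> (\<Union>t\<in>T. ball (f t) (1/8))"
    using compactE_image[of "f ` sphere 0 1" "sphere 0 1" "\<lambda>t. ball (f t) (1/8)"] open_ball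
    by metis
  \<comment> \<open>The radius 3/8 = 1/4 + 1/8 gives positive weight to a net point whose image is
    within 1/8 of \<open>f x\<close>, for every admissible \<open>y\<close>.\<close>
  define w where "w t y = max 0 (3/8 - norm (y - f t))" for t y
  define g where "g y = (\<Sum>t\<in>T. w t y *\<^sub>R t)" for y
  have "continuous_on UNIV g"
    unfolding g_def w_def by (intro continuous_intros)
  moreover have "g y \<bullet> x > 0" if x: "x \<in> sphere 0 1" and y: "norm (y - f x) \<le> 1/4" for x y
  proof -
    have pos: "t \<bullet> x > 0" if "t \<in> T" "w t y > 0" for t
    proof -
      have "norm (y - f t) < 3/8"
        using that(2) by (auto simp: w_def)
      then have "norm (f t - f x) < 5/8"
        using y norm_triangle_ineq4[of "y - f x" "y - f t"] by simp
      \<comment> \<open>The expansion bound gives 5/8 + \<delta> < 7/8. Below 1, the identity |t -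
        x|^2 = 2 - 2 \<open>t \<bullet> x\<close> for unit vectors forces
        \<open>t \<bullet> x > 0\<close>.\<close>
      then have "norm (t - x) < 1"
        using exp[of t x] T(1) \<open>t \<in> T\<close> x \<delta> by force
      then have "(norm (t - x))\<^sup>2 < 1"
        by (simp add: power_less_one_iff)
      moreover have "norm t = 1" "norm x = 1"
        using x T(1) \<open>t \<in> T\<close> by auto
      ultimately show ?thesis
        by (simp add: power2_norm_eq_inner inner_diff inner_commute norm_eq_1)
    qed
    obtain t where t: "t \<in> T" "norm (f t - f x) < 1/8"
      using T(3) x by (force simp: dist_norm image_subset_iff)
    then have "norm (y - f t) < 3/8"
      using y norm_triangle_ineq4[of "y - f x" "f t - f x"] by simp
    then have "w t y > 0"
      by (auto simp: w_def)
    have "0 \<le> w s y * (s \<bullet> x)" if "s \<in> T" for s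
    proof (cases "w s y > 0")
      case True
      then show ?thesis
        using pos[OF that] by simp
    next
      case False
      then have "w s y = 0"
        by (simp add: w_def)
      then show ?thesis
        by simp
    qed
    moreover have "0 < w t y * (t \<bullet> x)"
      using \<open>w t y > 0\<close> pos[OF t(1)] by simp
    ultimately have "0 < (\<Sum>t\<in>T. w t y * (t \<bullet> x))"
      using T(2) t(1) by (intro sum_pos2[of T t]) auto
    then show ?thesis
      by (simp add: g_def inner_sum_left)
  qed
  ultimately show ?thesis
    using that by blast
qed

lemma coarse_embedding_not_mutually_outside:
  fixes f h :: "'a::euclidean_space \<Rightarrow> 'a"
  assumes dim: "2 \<le> DIM('a)" and \<delta>: "\<delta> < 1/4"
    and contf: "continuous_on (sphere 0 1) f" and conth: "continuous_on (sphere 0 1) h"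
    and exp: "\<And>x y. \<lbrakk>x \<in> sphere 0 1; y \<in> sphere 0 1\<rbrakk> \<Longrightarrow> norm (x - y) - \<delta> \<le> norm (f x - f y)"
    and close: "\<And>x. x \<in> sphere 0 1 \<Longrightarrow> norm (f x - h x) \<le> 1/4"
    and fh: "f ` sphere 0 1 \<subseteq> outside (h ` sphere 0 1)"
    and hf: "h ` sphere 0 1 \<subseteq> outside (f ` sphere 0 1)"
  shows False
proof -
  let ?S = "sphere (0::'a) 1"
  let ?F = "f ` ?S" and ?H = "h ` ?S"
  obtain g where contg: "continuous_on UNIV g"
    and g: "\<And>x y. \<lbrakk>x \<in> ?S; norm (y - f x) \<le> 1/4\<rbrakk> \<Longrightarrow> g y \<bullet> x > 0"
    using coarse_embedding_approximate_inverse[OF \<delta> contf exp] by blast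
  have compF: "compact ?F" and compH: "compact ?H"
    using contf conth by (auto intro!: compact_continuous_image)
  have Un: "outside ?F \<union> outside ?H = UNIV"
    by (rule outside_Un_outside_eq_UNIV[OF compF compH fh hf])
  \<comment> \<open>The union of the segments, written as the image of a compact cylinder.\<close>
  define M where "M = (\<lambda>(t, x). (1 - t) *\<^sub>R f x + t *\<^sub>R h x) ` ({0..1} \<times> ?S)"
  have compM: "compact M"
    unfolding M_def case_prod_unfold
    by (intro compact_continuous_image compact_Times compact_sphere compact_Icc continuous_intros
        continuous_on_compose2[OF contf] continuous_on_compose2[OF conth]) auto
  have seg: "closed_segment (f x) (h x) \<subseteq> M" if "x \<in> ?S" for x
    using that by (force simp: M_def closed_segment_def)
  have gM: "g y \<noteq> 0" if "y \<in> M" for y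
  proof -
    obtain x where x: "x \<in> ?S" "y \<in> closed_segment (f x) (h x)"
      using \<open>y \<in> M\<close> by (force simp: M_def closed_segment_def)
    have "norm (y - f x) \<le> 1/4"
      using segment_bound1[OF x(2)] close[OF x(1)] by (simp add: norm_minus_commute)
    then show ?thesis
      using g[OF x(1)] by fastforce
  qed
  \<comment> \<open>Extending only from the part of \<open>M\<close> in the filling of
    \<open>?F\<close> allows all punctures to be placed in that filling.\<close>
  define Y where "Y = M \<inter> - outside ?F"
  have compY: "compact Y"
    unfolding Y_def
    by (intro compact_Int_closed compM) (simp add: compF compact_imp_closed open_outside closed_Compl)
  have "f x \<in> M" if "x \<in> ?S" for x
    using seg[OF that] by auto
  then have FY: "?F \<subseteq> Y"
    using outside_no_overlap[of ?F] unfolding Y_def by blast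
  have contsg: "continuous_on Y (sgn \<circ> g)"
    using gM by (auto simp: Y_def o_def intro!: continuous_on_sgn continuous_on_subset[OF contg])
  have imsg: "sgn \<circ> g \<in> Y \<rightarrow> sphere 0 1"
    using gM by (auto simp: Y_def norm_sgn)
  \<comment> \<open>Otherwise \<open>C\<close> would, by maximality, contain the connected unbounded
    set \<open>outside ?F\<close>.\<close>
  have meets: "C \<inter> - outside ?F \<noteq> {}" if C: "C \<in> components (- Y)" "bounded C" for C
  proof
    assume "C \<inter> - outside ?F = {}"
    then have "C \<subseteq> outside ?F"
      by blast
    moreover have "connected (outside ?F)"
      using compF dim by (simp add: compact_imp_bounded connected_outside)
    moreover have "outside ?F \<subseteq> - Y"
      by (auto simp: Y_def)
    ultimately have "outside ?F \<subseteq> C"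
      using components_maximal[OF C(1)] in_components_nonempty[OF C(1)] by blast
    then show False
      using C(2) unbounded_outside[OF compact_imp_bounded[OF compF]] bounded_subset by blast
  qed
  \<comment> \<open>\<open>G\<close> agrees with \<open>sgn \<circ> g\<close> on \<open>Y\<close>
    but possibly not on the rest of \<open>M\<close>; below, it only has to be defined
    there.\<close>
  obtain P G where P: "P \<subseteq> - outside ?F" "disjnt P Y"
    and G: "continuous_on (- P) G" "G \<in> (- P) \<rightarrow> sphere 0 1"
    and GY: "\<And>x. x \<in> Y \<Longrightarrow> G x = (sgn \<circ> g) x"
    by (rule extend_map_UNIV_to_sphere_cofinite
        [OF order_refl zero_le_one compY contsg imsg meets]) (assumption | rule that)+
  have MP: "M \<subseteq> - P"
    using P by (auto simp: Y_def disjnt_iff)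
  let ?K = "- outside ?H"
  have HK: "h \<in> ?S \<rightarrow> ?K"
    using outside_no_overlap[of ?H] by blast
  \<comment> \<open>The punctures lie in the filling of \<open>?F\<close>, which is disjoint from
    \<open>?K\<close>, the filling of \<open>?H\<close>.\<close>
  have KP: "?K \<subseteq> - P"
    using P Un by blast
  have compK: "compact ?K"
    using compH cobounded_outside[of ?H]
    by (simp add: compact_eq_bounded_closed open_outside closed_Compl)
  have "connected (- ?K)"
    using compH dim by (simp add: compact_imp_bounded connected_outside)
  moreover have "continuous_on ?K G" "G \<in> ?K \<rightarrow> sphere 0 1"
    using G KP by (auto intro: continuous_on_subset)
  ultimately obtain c where "homotopic_with_canon (\<lambda>x. True) ?K (sphere 0 1) G (\<lambda>x. c)"
    using Borsuk_separation_theorem[OF compK dim] by blast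
  then have "homotopic_with_canon (\<lambda>x. True) ?S (sphere 0 1) (G \<circ> h) ((\<lambda>x. c) \<circ> h)"
    using HK by (intro homotopic_with_compose_continuous_right conth) auto
  \<comment> \<open>The straight-line homotopy stays in \<open>M\<close>, which contains no
    puncture.\<close>
  moreover have "homotopic_with_canon (\<lambda>x. True) ?S (- P) f h"
    using seg MP by (intro homotopic_with_linear contf conth) blast
  then have "homotopic_with_canon (\<lambda>x. True) ?S (sphere 0 1) (G \<circ> f) (G \<circ> h)"
    using G by (intro homotopic_with_compose_continuous_left) auto
  moreover have "homotopic_with_canon (\<lambda>x. True) ?S (sphere 0 1) id (G \<circ> f)"
  proof -
    \<comment> \<open>Pairing with \<open>x\<close> is positive at both ends of the segment. So
      \<open>id\<close> deforms to \<open>g \<circ> f\<close> away from 0, and applying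
      \<open>sgn\<close> brings the homotopy back to the sphere.\<close>
    have "0 \<notin> closed_segment x (g (f x))" if x: "x \<in> ?S" for x
    proof
      assume "0 \<in> closed_segment x (g (f x))"
      then obtain u where u: "0 \<le> u" "u \<le> 1" "0 = (1 - u) *\<^sub>R x + u *\<^sub>R g (f x)"
        by (auto simp: closed_segment_def)
      have x1: "x \<bullet> x = 1" and pos: "g (f x) \<bullet> x > 0"
        using x g[OF x, of "f x"] by (auto simp: norm_eq_1)
      have eq: "0 = 1 - u + u * (g (f x) \<bullet> x)"
        using arg_cong[OF u(3), of "\<lambda>v. v \<bullet> x"] x1 by (simp add: inner_add_left)
      then have "u \<noteq> 0"
        by auto
      then have "0 < u * (g (f x) \<bullet> x)"
        using u(1) pos by simp
      then show False
        using eq u(2) by linarith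
    qed
    then have "homotopic_with_canon (\<lambda>x. True) ?S (- {0}) id (g \<circ> f)"
      using contf continuous_on_compose[OF contf continuous_on_subset[OF contg]]
      by (intro homotopic_with_linear) auto
    then have "homotopic_with_canon (\<lambda>x. True) ?S (sphere 0 1) (sgn \<circ> id) (sgn \<circ> (g \<circ> f))"
      by (rule homotopic_with_compose_continuous_left)
        (auto simp: norm_sgn intro!: continuous_on_sgn)
    then show ?thesis
    proof (rule homotopic_with_eq)
      show "(G \<circ> f) x = (sgn \<circ> (g \<circ> f)) x" if "x \<in> topspace (top_of_set ?S)" for x
        using that FY GY[of "f x"] by (simp add: image_subset_iff)
    qed (auto simp: sgn_div_norm)
  qed
  \<comment> \<open>The chain runs from \<open>id\<close> through \<open>G \<circ> f\<close> and
    \<open>G \<circ> h\<close> to a constant, which would contract the sphere.\<close>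
  ultimately have "homotopic_with_canon (\<lambda>x. True) ?S ?S id ((\<lambda>x. c) \<circ> h)"
    by (meson homotopic_with_trans)
  then have "contractible ?S"
    by (auto simp: contractible_def o_def)
  then show False
    by (simp add: contractible_sphere)
qed

theorem corollary2p2:
  fixes f :: "nat \<Rightarrow> real ^ 'd \<Rightarrow> real ^ 'd"
    and n :: nat and \<delta> :: real
  assumes "CARD('d) \<ge> 2"
    and "\<delta> < 1/4"
    and "\<And>i. i \<in> {1..n} \<Longrightarrow> continuous_on (sphere 0 1) (f i)"
    and "\<And>i x y. \<lbrakk>i \<in> {1..n}; x \<in> sphere 0 1; y \<in> sphere 0 1\<rbrakk>
           \<Longrightarrow> norm (f i x - f i y) \<ge> norm (x - y) - \<delta>"
    and "\<And>i j x. \<lbrakk>i \<in> {1..n}; j \<in> {1..n}; x \<in> sphere 0 1\<rbrakk>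
           \<Longrightarrow> norm (f i x - f j x) \<le> 1/4"
    and "\<And>i j. \<lbrakk>i \<in> {1..n}; j \<in> {1..n}; i \<noteq> j\<rbrakk>
           \<Longrightarrow> f i ` sphere 0 1 \<inter> f j ` sphere 0 1 = {}"
  shows "linear_order_on {1..n}
           {(i, j). i \<in> {1..n} \<and> j \<in> {1..n} \<and>
              unbounded_component (f j ` sphere 0 1) \<subseteq> unbounded_component (f i ` sphere 0 1)}"
proof -
  let ?S = "sphere (0 :: real ^ 'd) 1"
  let ?U = "\<lambda>i. outside (f i ` ?S)"
  have dim: "2 \<le> DIM(real ^ 'd)"
    using assms(1) by simp
  have comp: "compact (f i ` ?S)" if "i \<in> {1..n}" for i
    using assms(3)[OF that] by (intro compact_continuous_image compact_sphere)
  have conn: "connected (f i ` ?S)" if "i \<in> {1..n}" for i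
    using assms(3)[OF that] dim by (intro connected_continuous_image connected_sphere)
  have U: "unbounded_component (f i ` ?S) = ?U i" if "i \<in> {1..n}" for i
    using unbounded_component_eq_outside comp[OF that] dim by (blast intro: compact_imp_bounded)
  have total: "?U j \<subseteq> ?U i \<or> ?U i \<subseteq> ?U j" if ij: "i \<in> {1..n}" "j \<in> {1..n}" "i \<noteq> j" for i j
  proof (rule ccontr)
    assume "\<not> ?thesis"
    \<comment> \<open>The contrapositive of \<open>outside_subset_outside\<close>, applied both
      ways.\<close>
    then have "f i ` ?S \<subseteq> ?U j" "f j ` ?S \<subseteq> ?U i"
      using outside_subset_outside[of "f i ` ?S" "f j ` ?S"]
        outside_subset_outside[of "f j ` ?S" "f i ` ?S"]
        ij comp conn dim assms(6)[OF ij] assms(6)[OF ij(2,1)] by (auto simp: compact_imp_bounded)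
    then show False
      using coarse_embedding_not_mutually_outside[OF dim assms(2), of "f i" "f j"]
        assms(3-5) ij by blast
  qed
  have antisym: "i = j" if ij: "i \<in> {1..n}" "j \<in> {1..n}" "?U i = ?U j" for i j
  proof (rule ccontr)
    assume "i \<noteq> j"
    have "frontier (?U i) \<subseteq> f i ` ?S" "frontier (?U i) \<subseteq> f j ` ?S"
      using ij comp frontier_outside_subset by (metis compact_imp_closed)+
    then have "frontier (?U i) = {}"
      using assms(6)[OF ij(1,2) \<open>i \<noteq> j\<close>] by blast
    \<comment> \<open>With empty frontier, \<open>?U i\<close> would be empty or the whole space; it
      is unbounded and misses the nonempty image of the sphere.\<close>
    moreover have "?U i \<noteq> {}"
      using unbounded_outside comp[OF ij(1)] by (metis bounded_empty compact_imp_bounded)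
    moreover have "?U i \<noteq> UNIV"
      using outside_no_overlap[of "f i ` ?S"] by (metis image_is_empty inf_top_left
          not_one_less_zero sphere_eq_empty)
    ultimately show False
      by (simp add: frontier_eq_empty)
  qed
  have rel: "{(i, j). i \<in> {1..n} \<and> j \<in> {1..n} \<and>
      unbounded_component (f j ` ?S) \<subseteq> unbounded_component (f i ` ?S)} =
    {(i, j). i \<in> {1..n} \<and> j \<in> {1..n} \<and> ?U j \<subseteq> ?U i}"
    using U by auto
  show ?thesis
    unfolding rel linear_order_on_def partial_order_on_def preorder_on_def
  proof (intro conjI)
    show "antisym {(i, j). i \<in> {1..n} \<and> j \<in> {1..n} \<and> ?U j \<subseteq> ?U i}"
      using antisym by (intro antisymI) blast
    show "total_on {1..n} {(i, j). i \<in> {1..n} \<and> j \<in> {1..n} \<and> ?U j \<subseteq> ?U i}"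
      using total by (simp add: total_on_def)
  qed (auto simp: refl_on_def trans_def)
qed

end
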